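(* Consider the event-triggered decentralized algorithm described in the context, with data $n$, $\mathcal G$, $f_i$, $\beta$, $H$, $E_{i,k}$ (and $g_i=0$ for all $i$, i.e. no nonsmooth part in the objective). Assume: (1) the graph $\mathcal G$ is fixed and connected; (2) the sequence $E_k=\max_{1\le i\le n}E_{i,k}$, $k\in\mathbb N$, is non-increasing and $\sum_{k=0}^\infty E_k<\infty$; (3) each $f_i:\mathbb R\to\mathbb R$ is convex and differentiable with $|\nabla f_i(x)-\nabla f_i(y)|\le l_{f_i}|x-y|$ for all $x,y\in\mathbb R$, where $l_{f_i}>0$; (4) each $f_i$ is strongly convex with parameter $\mu_{f_i}>0$, i.e. $(\nabla f_i(x)-\nabla f_i(y))(x-y)\ge\mu_{f_i}|x-y|^2$ for all $x,y\in\mathbb R$. Put $L_f=\mathrm{diag}(l_{f_1},\dots,l_{f_n})$, $M=\mathrm{diag}(\mu_{f_1},\dots,\mu_{f_n})$, $P=H-\beta\mathcal L$, and assume that $$P-\frac{L_f^2}{k_1}\succ0\quad\text{for some }0<k_1<2\underline\lambda(M).$$ Let $(x^*,y^* )$ be an optimal primal-dual pair and $z^*=\sqrt{\mathcal L}y^*$. Then there exists some positive $\sigma$ such that $$\frac12\|x_k-x^*\|^2_{P+k_4Q}+\frac12\|z_k-z^*\|^2_{(\beta\mathcal L+\frac{\mathbf 1\mathbf 1^{\mathrm T}}{n})^{-1}}+nC E_k^2\ \ge\ \frac{\sigma+1}{2}\Big(\|x_{k+1}-x^*\|^2_{P+k_4Q}+\|z^*-z_{k+1}\|^2_{(\beta\mathcal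 L+\frac{\mathbf 1\mathbf 1^{\mathrm T}}{n})^{-1}}\Big)$$ (for every iteration index $k$), where $Q=2M-k_1I_n$, where $k_2,k_3,k_4,k_5$ are free parameters with $0<k_2$, $2<k_3$, $0<k_4<1$, $0<k_5$, and where $$C=\frac{2\big(k_3+\frac1{k_2}-1\big)(\sigma+k_5)\,\overline\lambda(\beta^2\mathcal L^2)}{\big(1-\frac2{k_3}\big)\underline\lambda(\beta\mathcal L+\frac{\mathbf 1\mathbf 1^{\mathrm T}}{n})}+\frac{\overline\lambda(\beta\mathcal L+\frac{\mathbf 1\mathbf 1^{\mathrm T}}{n})}{2k_5}+\frac{2\overline\lambda(\beta^2\mathcal L^2)}{k_5\,\underline\lambda(P+k_4Q)}.$$
   Context: Notation. $\mathbf 1\in\mathbb R^n$ is the all-ones column vector. For a symmetric matrix $W$, $\overline\lambda(W)$ and $\underline\lambda(W)$ are its largest and smallest eigenvalues; $W\succ0$ ($\succeq0$) means positive (semi)definite; $\|x\|_W=\sqrt{x^{\mathrm T}Wx}$. Graph. $\mathcal G=(\mathcal V,\mathcal E)$ is a simple undirected graph on $\mathcal V=\{1,\dots,n\}$, $\mathcal N_i$ is the set of neighbors of $i$, and $\mathcal L=\mathcal D-\mathcal A$ is the graph Laplacian ($\mathcal A$ the 0/1 adjacency matrix, $\mathcal D$ the diagonal degree matrix). $\mathcal L\succeq 0$ and $\sqrt{\mathcal L}$ is its positive semidefinite square root. Problem. The decision variable is scalar ($m=1$) and the objective is smooth. For $x=(x_1,\dots,x_n)^{\mathrm T}\in\mathbb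 R^n$ put $f(x)=\sum_i f_i(x_i)$. The problem is $\min_{x\in\mathbb R^n}f(x)$ subject to $\sqrt{\mathcal L}x=0$. An optimal primal-dual pair is a pair $(x^*,y^* )\in\mathbb R^n\times\mathbb R^n$ with $\nabla f(x^* )+\sqrt{\mathcal L}y^*=0$ and $\sqrt{\mathcal L}x^*=0$. Algorithm. Parameters: $\beta>0$, a diagonal matrix $H=\mathrm{diag}(\eta_1,\dots,\eta_n)\succ0$, and thresholds $E_{i,k}\ge0$ ($1\le i\le n$, $k\in\mathbb N=\{0,1,2,\dots\}$). Start from any $x_0=(x_{1,0},\dots,x_{n,0})^{\mathrm T}\in\mathbb R^n$, with $z_{i,0}=0$ and $\tilde x_{i,0}=x_{i,0}$ for all $i$. For $k=0,1,2,\dots$ and each $i$: $$x_{i,k+1}=x_{i,k}-\frac1{\eta_i}\Big(z_{i,k}+\nabla f_i(x_{i,k})+\beta\sum_{j\in\mathcal N_i}(\tilde x_{i,k}-\tilde x_{j,k})\Big),$$ then $\tilde x_{i,k+1}=x_{i,k+1}$ if $|x_{i,k+1}-\tilde x_{i,k}|>E_{i,k+1}$ and $\tilde x_{i,k+1}=\tilde x_{i,k}$ otherwise, and then $$z_{i,k+1}=z_{i,k}+\beta\sum_{j\in\mathcal N_i}(\tilde x_{i,k+1}-\tilde x_{j,k+1}).$$ Write $x_k=(x_{1,k},\dots,x_{n,k})^{\mathrm T}$ and $z_k=(z_{1,k},\dots,z_{n,k})^{\mathrm T}$.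
   Formalization: The free parameter k_5 is restricted to 0<k_5<k_5^max for some positive bound depending on the other data (k_2, k_3, k_4 remain arbitrary in their ranges); for arbitrary k_5>0 a positive σ need not exist. *)

theory Defs
  imports "HOL-Analysis.Analysis"
begin

section \<open>Symmetric matrices\<close>

definition diag_matrix :: "real^'n \<Rightarrow> real^'n^'n" where
  "diag_matrix d = (\<chi> i j. if i = j then d $ i else 0)"

definition posdef :: "real^'n^'n \<Rightarrow> bool" where
  "posdef W \<longleftrightarrow> transpose W = W \<and> (\<forall>x. x \<noteq> 0 \<longrightarrow> x \<bullet> (W *v x) > 0)"

definition possemidef :: "real^'n^'n \<Rightarrow> bool" where
  "possemidef W \<longleftrightarrow> transpose W = W \<and> (\<forall>x. x \<bullet> (W *v x) \<ge> 0)"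

definition eigenvalues :: "real^'n^'n \<Rightarrow> real set" where
  "eigenvalues W = {c. \<exists>v. v \<noteq> 0 \<and> W *v v = c *\<^sub>R v}"

text \<open>These are only used for symmetric matrices, whose set of (real) eigenvalues is finite
  and nonempty.\<close>

definition lambda_max :: "real^'n^'n \<Rightarrow> real" where
  "lambda_max W = Max (eigenvalues W)"

definition lambda_min :: "real^'n^'n \<Rightarrow> real" where
  "lambda_min W = Min (eigenvalues W)"

definition wnorm :: "real^'n^'n \<Rightarrow> real^'n \<Rightarrow> real" where
  "wnorm W x = sqrt (x \<bullet> (W *v x))"

text \<open>The positive semidefinite square root of a positive semidefinite matrix exists and is
  unique; it is introduced by its defining property.\<close>

definition is_psd_sqrt :: "real^'n^'n \<Rightarrow> real^'n^'n \<Rightarrow> bool" where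
  "is_psd_sqrt S W \<longleftrightarrow> possemidef S \<and> S ** S = W"

definition averaging_matrix :: "real^'n^'n" where
  "averaging_matrix =
     (1 / real CARD('n)) *\<^sub>R ((columnvector 1 :: real^1^'n) ** (rowvector 1 :: real^'n^1))"


section \<open>Graphs\<close>

text \<open>A graph on the finite vertex type \<open>'n\<close> is given by its adjacency relation.\<close>

definition simple_graph :: "('n \<Rightarrow> 'n \<Rightarrow> bool) \<Rightarrow> bool" where
  "simple_graph adj \<longleftrightarrow> symp adj \<and> irreflp adj"

definition connected_graph :: "('n \<Rightarrow> 'n \<Rightarrow> bool) \<Rightarrow> bool" where
  "connected_graph adj \<longleftrightarrow> (\<forall>i j. adj\<^sup>*\<^sup>* i j)"

definition neighbors :: "('n \<Rightarrow> 'n \<Rightarrow> bool) \<Rightarrow> 'n \<Rightarrow> 'n set" where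
  "neighbors adj i = {j. adj i j}"

definition adjacency_matrix :: "('n \<Rightarrow> 'n \<Rightarrow> bool) \<Rightarrow> real^'n^'n" where
  "adjacency_matrix adj = (\<chi> i j. if adj i j then 1 else 0)"

definition degree_matrix :: "('n::finite \<Rightarrow> 'n \<Rightarrow> bool) \<Rightarrow> real^'n^'n" where
  "degree_matrix adj = diag_matrix (\<chi> i. real (card (neighbors adj i)))"

definition laplacian :: "('n::finite \<Rightarrow> 'n \<Rightarrow> bool) \<Rightarrow> real^'n^'n" where
  "laplacian adj = degree_matrix adj - adjacency_matrix adj"


section \<open>Problem and algorithm\<close>

definition objective :: "('n::finite \<Rightarrow> real \<Rightarrow> real) \<Rightarrow> real^'n \<Rightarrow> real" where
  "objective f x = (\<Sum>i\<in>UNIV. f i (x $ i))"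

text \<open>Here \<open>S\<close> stands for the square root of the Laplacian.\<close>

definition optimal_pair ::
  "('n::finite \<Rightarrow> real \<Rightarrow> real) \<Rightarrow> real^'n^'n \<Rightarrow> real^'n \<Rightarrow> real^'n \<Rightarrow> bool" where
  "optimal_pair f S x y \<longleftrightarrow>
     (\<exists>g. GDERIV (objective f) x :> g \<and> g + S *v y = 0) \<and> S *v x = 0"

text \<open>\<open>xt\<close> is the sequence of last broadcast values; \<open>thr i k\<close> is the threshold
  of agent \<open>i\<close> at iteration \<open>k\<close>.\<close>

definition event_triggered_run ::
  "('n::finite \<Rightarrow> 'n \<Rightarrow> bool) \<Rightarrow> ('n \<Rightarrow> real \<Rightarrow> real) \<Rightarrow> real \<Rightarrow> real^'n \<Rightarrow> ('n \<Rightarrow> nat \<Rightarrow> real)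
    \<Rightarrow> (nat \<Rightarrow> real^'n) \<Rightarrow> (nat \<Rightarrow> real^'n) \<Rightarrow> (nat \<Rightarrow> real^'n) \<Rightarrow> bool" where
  "event_triggered_run adj f \<beta> \<eta> thr x xt z \<longleftrightarrow>
     z 0 = 0 \<and> xt 0 = x 0 \<and>
     (\<forall>k i.
        x (Suc k) $ i =
          x k $ i - (1 / \<eta> $ i) *
            (z k $ i + deriv (f i) (x k $ i) + \<beta> * (\<Sum>j\<in>neighbors adj i. xt k $ i - xt k $ j)) \<and>
        xt (Suc k) $ i =
          (if \<bar>x (Suc k) $ i - xt k $ i\<bar> > thr i (Suc k) then x (Suc k) $ i else xt k $ i) \<and>
        z (Suc k) $ i =
          z k $ i + \<beta> * (\<Sum>j\<in>neighbors adj i. xt (Suc k) $ i - xt (Suc k) $ j))"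

definition max_threshold :: "('n::finite \<Rightarrow> nat \<Rightarrow> real) \<Rightarrow> nat \<Rightarrow> real" where
  "max_threshold thr k = Max (range (\<lambda>i. thr i k))"

text \<open>The constant \<open>C\<close> multiplying \<open>n E\<^sub>k\<^sup>2\<close>, with \<open>R = P + k\<^sub>4 Q\<close>.
  The sum \<open>\<sigma> + k\<^sub>5\<close> has to stay below the contraction margin of the error-free iteration, so the
  estimate with some \<open>\<sigma> > 0\<close> can be expected only for small \<open>k\<^sub>5 > 0\<close>.\<close>

definition error_const ::
  "real \<Rightarrow> real^'n^'n \<Rightarrow> real^'n^'n \<Rightarrow> real \<Rightarrow> real \<Rightarrow> real \<Rightarrow> real \<Rightarrow> real" where
  "error_const \<beta> L R k2 k3 k5 \<sigma> =
     2 * (k3 + 1 / k2 - 1) * (\<sigma> + k5) * lambda_max (\<beta>\<^sup>2 *\<^sub>R (L ** L))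
       / ((1 - 2 / k3) * lambda_min (\<beta> *\<^sub>R L + averaging_matrix))
     + lambda_max (\<beta> *\<^sub>R L + averaging_matrix) / (2 * k5)
     + 2 * lambda_max (\<beta>\<^sup>2 *\<^sub>R (L ** L)) / (k5 * lambda_min R)"

end

theory Submission
  imports Defs
begin

text \<open>With \<open>e\<^sub>k = xt\<^sub>k - x\<^sub>k\<close>, eliminating \<open>z\<^sub>k\<close> turns one iteration into
  \<open>P (x\<^sub>k - x\<^sub>k\<^sub>+\<^sub>1) = (z\<^sub>k\<^sub>+\<^sub>1 - z\<^sup>*) + (\<nabla>f x\<^sub>k - \<nabla>f x\<^sup>*) + \<beta> L (e\<^sub>k - e\<^sub>k\<^sub>+\<^sub>1)\<close>.
  Pairing this with \<open>x\<^sub>k\<^sub>+\<^sub>1 - x\<^sup>*\<close> gives an exact energy balance: since \<open>z\<^sub>k - z\<^sup>*\<close> has mean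
  zero, \<open>W\<^sup>-\<^sup>1\<close> inverts \<open>\<beta> L\<close> on it. Strong convexity and the Lipschitz bound turn the gradient
  term into a surplus \<open>Q\<close>-norm of \<open>x\<^sub>k\<^sub>+\<^sub>1 - x\<^sup>*\<close>, at the price of \<open>L\<^sub>f\<^sup>2 / k\<^sub>1\<close> in the norm of
  \<open>x\<^sub>k - x\<^sub>k\<^sub>+\<^sub>1\<close>. The same equation bounds \<open>z\<^sub>k\<^sub>+\<^sub>1 - z\<^sup>*\<close> by \<open>x\<^sub>k - x\<^sub>k\<^sub>+\<^sub>1\<close>, \<open>x\<^sub>k - x\<^sup>*\<close> and the
  errors, so these surplus terms absorb a multiple \<open>s = \<sigma> + k\<^sub>5\<close> of the new energy. Hence
  \<open>s\<close> can be fixed first, and any \<open>k\<^sub>5 < s\<close> works with \<open>\<sigma> = s - k\<^sub>5\<close>.\<close>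

section \<open>Symmetric matrices\<close>

lemma symmetric_dot: "transpose A = A \<Longrightarrow> (A *v x) \<bullet> y = x \<bullet> ((A::real^'n^'n) *v y)"
  by (metis dot_lmul_matrix transpose_matrix_vector)

lemma form_add: "transpose A = A \<Longrightarrow>
    (x + y) \<bullet> ((A::real^'n^'n) *v (x + y)) = x \<bullet> (A *v x) + 2 * (x \<bullet> (A *v y)) + y \<bullet> (A *v y)"
  using symmetric_dot[of A y x]
  by (simp add: matrix_vector_right_distrib inner_add_left inner_add_right inner_commute)

lemma form_scaleR: "(c *\<^sub>R x) \<bullet> ((A::real^'n^'n) *v (c *\<^sub>R x)) = c\<^sup>2 * (x \<bullet> (A *v x))"
  by (simp add: matrix_vector_mult_scaleR power2_eq_square)

lemma form_diff: "transpose A = A \<Longrightarrow>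
    (x - y) \<bullet> ((A::real^'n^'n) *v (x - y)) = x \<bullet> (A *v x) - 2 * (x \<bullet> (A *v y)) + y \<bullet> (A *v y)"
  using symmetric_dot[of A y x]
  by (simp add: matrix_vector_mult_diff_distrib inner_diff_left inner_diff_right inner_commute)

lemma transpose_add: "transpose (A + B) = transpose A + transpose (B::'a::plus^'n^'m)"
  by (simp add: transpose_def vec_eq_iff)

lemma transpose_diff: "transpose (A - B) = transpose A - transpose (B::'a::minus^'n^'m)"
  by (simp add: transpose_def vec_eq_iff)

lemma scaleR_mult_vec: "(c *\<^sub>R A) *v x = c *\<^sub>R ((A::real^'n^'m) *v x)"
  by (simp add: scaleR_matrix_vector_assoc)

text \<open>If \<open>w = A *v v\<close> were nonzero, a small move from \<open>v\<close> against
  \<open>w\<close> would push the form below its value zero to first order, contradicting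
  semidefiniteness.\<close>

lemma psd_form_zero_imp_kernel:
  fixes A :: "real^'n^'n"
  assumes "possemidef A" and "v \<bullet> (A *v v) = 0"
  shows "A *v v = 0"
proof (rule ccontr)
  assume ne: "A *v v \<noteq> 0"
  define w where "w = A *v v"
  define d where "d = w \<bullet> w"
  define c where "c = w \<bullet> (A *v w)"
  have sym: "transpose A = A" and nn: "\<And>x. x \<bullet> (A *v x) \<ge> 0"
    using assms by (auto simp: possemidef_def)
  have d: "d > 0" using ne by (simp add: d_def w_def)
  have c: "c \<ge> 0" using nn by (simp add: c_def)
  \<comment> \<open>Any small enough negative step works; the \<open>+ 1\<close> keeps the
    denominator positive when \<open>c = 0\<close>.\<close>
  define t where "t = - d / (c + 1)"
  have "v \<bullet> (A *v w) = d"
    using symmetric_dot[OF sym, of v w] by (simp add: d_def w_def)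
  moreover have "w \<bullet> (A *v v) = d" by (simp add: d_def w_def)
  ultimately have "(v + t *\<^sub>R w) \<bullet> (A *v (v + t *\<^sub>R w)) = t * (2 * d + t * c)"
    using assms(2) by (simp add: form_add[OF sym] form_scaleR matrix_vector_mult_scaleR c_def
        power2_eq_square algebra_simps)
  also have "\<dots> < 0"
  proof -
    have "2 * d + t * c = d * (c + 2) / (c + 1)"
      using c by (simp add: t_def field_simps)
    also have "\<dots> > 0" using c d by simp
    finally have "2 * d + t * c > 0" .
    moreover have "t < 0" using c d by (simp add: t_def)
    ultimately show ?thesis by (simp add: mult_neg_pos)
  qed
  finally show False using nn[of "v + t *\<^sub>R w"] by simp
qed

text \<open>The form attains its minimum \<open>m\<close> on the compact unit sphere. Subtracting
  \<open>m\<close> times the identity leaves a semidefinite matrix whose form vanishes at the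
  minimizer, so the minimizer lies in its kernel and is an eigenvector of \<open>A\<close>.\<close>

lemma ex_minimal_eigenvalue:
  fixes A :: "real^'n^'n"
  assumes sym: "transpose A = A"
  shows "\<exists>m\<in>eigenvalues A. \<forall>x. m * (x \<bullet> x) \<le> x \<bullet> (A *v x)"
proof -
  have "\<exists>v\<in>sphere (0::real^'n) 1. \<forall>x\<in>sphere 0 1. v \<bullet> (A *v v) \<le> x \<bullet> (A *v x)"
  proof (rule continuous_attains_inf)
    show "continuous_on (sphere 0 1) (\<lambda>x. x \<bullet> (A *v x))"
      by (intro continuous_on_inner continuous_on_id linear_continuous_on
          matrix_vector_mul_bounded_linear)
  qed simp_all
  then obtain v where v: "norm v = 1" and
    min: "\<And>x. norm x = 1 \<Longrightarrow> v \<bullet> (A *v v) \<le> x \<bullet> (A *v x)"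
    by auto
  define m where "m = v \<bullet> (A *v v)"
  have le: "m * (x \<bullet> x) \<le> x \<bullet> (A *v x)" for x
  proof (cases "x = 0")
    case False
    define u where "u = (1 / norm x) *\<^sub>R x"
    have "x = norm x *\<^sub>R u" "norm u = 1" using False by (auto simp: u_def)
    then have "x \<bullet> (A *v x) = (norm x)\<^sup>2 * (u \<bullet> (A *v u))"
      by (metis form_scaleR)
    also have "\<dots> \<ge> (norm x)\<^sup>2 * m"
      using min[OF \<open>norm u = 1\<close>] by (simp add: m_def mult_left_mono)
    finally show ?thesis by (simp add: power2_norm_eq_inner mult.commute)
  qed simp
  define B where "B = A - m *\<^sub>R mat 1"
  have B: "B *v x = A *v x - m *\<^sub>R x" for x
    by (simp add: B_def matrix_vector_mult_diff_rdistrib scaleR_mult_vec)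
  have "possemidef B"
    unfolding possemidef_def
  proof
    show "transpose B = B"
      by (simp add: B_def transpose_diff sym transpose_scalar)
    show "\<forall>x. 0 \<le> x \<bullet> (B *v x)" using le by (simp add: B inner_diff_right)
  qed
  moreover have "v \<bullet> (B *v v) = 0"
    using v by (simp add: B inner_diff_right m_def norm_eq_1)
  ultimately have "B *v v = 0" by (rule psd_form_zero_imp_kernel)
  then have "m \<in> eigenvalues A" using v by (auto simp: B eigenvalues_def intro!: exI[of _ v])
  with le show ?thesis by blast
qed

lemma ex_maximal_eigenvalue:
  fixes A :: "real^'n^'n"
  assumes sym: "transpose A = A"
  shows "\<exists>m\<in>eigenvalues A. \<forall>x. x \<bullet> (A *v x) \<le> m * (x \<bullet> x)"
proof -
  have neg: "(- A) *v x = - (A *v x)" for x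
    using scaleR_mult_vec[of "-1" A x] by simp
  have "transpose (- A) = - A" using sym by (simp add: transpose_def vec_eq_iff)
  from ex_minimal_eigenvalue[OF this] obtain m v where
    v: "v \<noteq> 0" "(- A) *v v = m *\<^sub>R v" and le: "\<And>x. m * (x \<bullet> x) \<le> x \<bullet> ((- A) *v x)"
    by (auto simp: eigenvalues_def)
  have "A *v v = (- m) *\<^sub>R v" using v(2) unfolding neg by (metis minus_minus scaleR_minus_left)
  then have "- m \<in> eigenvalues A" using v(1) by (auto simp: eigenvalues_def)
  moreover have "x \<bullet> (A *v x) \<le> - m * (x \<bullet> x)" for x using le[of x] by (simp add: neg)
  ultimately show ?thesis by blast
qed

text \<open>Needed to make \<open>Max\<close> and \<open>Min\<close> of the eigenvalues meaningful.
  Choosing one eigenvector per eigenvalue gives a pairwise orthogonal, hence independent, hence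
  finite family.\<close>

lemma finite_eigenvalues:
  fixes A :: "real^'n^'n"
  assumes sym: "transpose A = A"
  shows "finite (eigenvalues A)"
proof -
  have "\<forall>c\<in>eigenvalues A. \<exists>v. v \<noteq> 0 \<and> A *v v = c *\<^sub>R v" by (auto simp: eigenvalues_def)
  then obtain e where e: "\<And>c. c \<in> eigenvalues A \<Longrightarrow> e c \<noteq> 0 \<and> A *v e c = c *\<^sub>R e c"
    by metis
  have inj: "inj_on e (eigenvalues A)"
    by (rule inj_onI) (metis e scaleR_cancel_right)
  have "pairwise orthogonal (e ` eigenvalues A)"
  proof (rule pairwiseI, clarify)
    fix c d assume cd: "c \<in> eigenvalues A" "d \<in> eigenvalues A" "e c \<noteq> e d"
    have "c * (e c \<bullet> e d) = d * (e c \<bullet> e d)"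
      using symmetric_dot[OF sym, of "e c" "e d"] e[OF cd(1)] e[OF cd(2)] by simp
    then show "orthogonal (e c) (e d)" using cd(3) by (auto simp: orthogonal_def)
  qed
  moreover have "0 \<notin> e ` eigenvalues A" using e by auto
  ultimately have "independent (e ` eigenvalues A)"
    by (rule pairwise_orthogonal_independent)
  then have "finite (e ` eigenvalues A)" by (rule finiteI_independent)
  then show ?thesis using inj by (rule finite_imageD)
qed

lemma lambda_max_ge:
  assumes "transpose A = A"
  shows "x \<bullet> (A *v x) \<le> lambda_max A * (x \<bullet> x)"
proof -
  obtain m where m: "m \<in> eigenvalues A" "x \<bullet> (A *v x) \<le> m * (x \<bullet> x)"
    using ex_maximal_eigenvalue[OF assms] by blast
  have "m \<le> lambda_max A"
    unfolding lambda_max_def using m(1) finite_eigenvalues[OF assms] by simp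
  with m(2) show ?thesis by (meson inner_ge_zero mult_right_mono order_trans)
qed

lemma lambda_min_le:
  assumes "transpose A = A"
  shows "lambda_min A * (x \<bullet> x) \<le> x \<bullet> (A *v x)"
proof -
  obtain m where m: "m \<in> eigenvalues A" "m * (x \<bullet> x) \<le> x \<bullet> (A *v x)"
    using ex_minimal_eigenvalue[OF assms] by blast
  have "lambda_min A \<le> m"
    unfolding lambda_min_def using m(1) finite_eigenvalues[OF assms] by simp
  with m(2) show ?thesis by (meson inner_ge_zero mult_right_mono order_trans)
qed

lemma lambda_min_pos:
  assumes "posdef A"
  shows "lambda_min A > 0"
proof -
  have sym: "transpose A = A" using assms by (simp add: posdef_def)
  then have "lambda_min A \<in> eigenvalues A"
    unfolding lambda_min_def using finite_eigenvalues ex_minimal_eigenvalue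
    by (intro Min_in) auto
  then obtain v where "v \<noteq> 0" "A *v v = lambda_min A *\<^sub>R v"
    by (auto simp: eigenvalues_def)
  moreover have "v \<bullet> (A *v v) > 0" using assms \<open>v \<noteq> 0\<close> by (simp add: posdef_def)
  moreover have "v \<bullet> v > 0" using \<open>v \<noteq> 0\<close> by simp
  ultimately show ?thesis by (metis inner_scaleR_right zero_less_mult_pos2)
qed

section \<open>Weighted norms and quadratic inequalities\<close>

lemma posdef_imp_possemidef: "posdef A \<Longrightarrow> possemidef A"
  unfolding posdef_def possemidef_def by (metis inner_zero_left order.order_iff_strict)

lemma wnorm_power2: "possemidef A \<Longrightarrow> (wnorm A x)\<^sup>2 = x \<bullet> (A *v x)"
  by (simp add: wnorm_def possemidef_def)

lemma posdef_mult_matrix_inv: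
  assumes "posdef A"
  shows "A *v (matrix_inv A *v x) = x"
proof -
  have "A *v v = 0 \<Longrightarrow> v = 0" for v
    using assms unfolding posdef_def by (metis inner_zero_right less_irrefl)
  then have "invertible A"
    by (simp add: invertible_left_inverse matrix_left_invertible_ker)
  then show ?thesis
    unfolding invertible_def matrix_inv_def
    by (metis (mono_tags, lifting) someI_ex matrix_vector_mul_assoc matrix_vector_mul_lid)
qed

text \<open>Trades the inverse for the preimage \<open>matrix_inv A *v x\<close>, so that later
  estimates involve only forms of \<open>A\<close> itself.\<close>

lemma wnorm_matrix_inv_power2:
  assumes "posdef A"
  shows "(wnorm (matrix_inv A) x)\<^sup>2 = (matrix_inv A *v x) \<bullet> (A *v (matrix_inv A *v x))"
proof -
  define y where "y = matrix_inv A *v x"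
  have x: "A *v y = x" using posdef_mult_matrix_inv[OF assms] by (simp add: y_def)
  have "y \<bullet> (A *v y) \<ge> 0" using posdef_imp_possemidef[OF assms] by (simp add: possemidef_def)
  then have "x \<bullet> y \<ge> 0" by (simp add: x inner_commute)
  then show ?thesis
    unfolding y_def[symmetric] wnorm_def x by (simp add: inner_commute)
qed

text \<open>For \<open>x = A *v y\<close> this bounds the inverse-weighted norm of \<open>x\<close>
  by its Euclidean norm. Cauchy-Schwarz bounds the squared form by
  \<open>(y \<bullet> y) * ((A *v y) \<bullet> (A *v y))\<close>; the eigenvalue bound absorbs
  \<open>y \<bullet> y\<close>, and one factor of the form cancels.\<close>

lemma lambda_min_form_le_norm:
  assumes "posdef A"
  shows "lambda_min A * (y \<bullet> (A *v y)) \<le> (A *v y) \<bullet> (A *v y)"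
proof (cases "y \<bullet> (A *v y) = 0")
  case False
  define l where "l = lambda_min A"
  define t where "t = y \<bullet> (A *v y)"
  have l: "l > 0" using lambda_min_pos[OF assms] by (simp add: l_def)
  have sym: "transpose A = A" using assms by (simp add: posdef_def)
  have t: "t > 0"
    using False posdef_imp_possemidef[OF assms] by (simp add: possemidef_def t_def order_less_le)
  have "t * (l * t) = l * t\<^sup>2" by (simp add: power2_eq_square)
  also have "\<dots> \<le> l * ((y \<bullet> y) * ((A *v y) \<bullet> (A *v y)))"
    using l Cauchy_Schwarz_ineq[of y "A *v y"] by (simp add: t_def)
  also have "\<dots> = (l * (y \<bullet> y)) * ((A *v y) \<bullet> (A *v y))" by simp
  also have "\<dots> \<le> t * ((A *v y) \<bullet> (A *v y))"
    using lambda_min_le[OF sym, of y] by (intro mult_right_mono) (auto simp: l_def t_def)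
  finally show ?thesis using t by (simp add: l_def[symmetric] t_def[symmetric])
qed simp

text \<open>Expanding the square of \<open>u - d *\<^sub>R w\<close> bounds the cross term;
  \<open>d\<close> shifts the cost between the two summands.\<close>

lemma norm_add_square_le:
  fixes u w :: "'a::real_inner"
  assumes "d > 0"
  shows "(u + w) \<bullet> (u + w) \<le> (1 + 1 / d) * (u \<bullet> u) + (1 + d) * (w \<bullet> w)"
proof -
  have "0 \<le> (1 / d) * ((u - d *\<^sub>R w) \<bullet> (u - d *\<^sub>R w))" using assms by simp
  also have "\<dots> = (1 / d) * (u \<bullet> u) - 2 * (u \<bullet> w) + d * (w \<bullet> w)"
    using assms by (simp add: inner_diff_left inner_diff_right inner_commute field_simps)
  finally show ?thesis
    by (simp add: inner_add_left inner_add_right inner_commute algebra_simps)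
qed

lemma inner_le_weighted:
  fixes u w :: "'a::real_inner"
  assumes "d > 0"
  shows "u \<bullet> w \<le> d / 2 * (u \<bullet> u) + 1 / (2 * d) * (w \<bullet> w)"
proof -
  have "0 \<le> (1 / (2 * d)) * ((d *\<^sub>R u - w) \<bullet> (d *\<^sub>R u - w))" using assms by simp
  also have "\<dots> = d / 2 * (u \<bullet> u) - u \<bullet> w + 1 / (2 * d) * (w \<bullet> w)"
    using assms by (simp add: inner_diff_left inner_diff_right inner_commute field_simps power2_eq_square)
  finally show ?thesis by simp
qed

lemma form_le_weighted:
  fixes A :: "real^'n^'n"
  assumes "possemidef A" "d > 0"
  shows "u \<bullet> (A *v w) \<le> d / 2 * (u \<bullet> (A *v u)) + 1 / (2 * d) * (w \<bullet> (A *v w))"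
proof -
  have sym: "transpose A = A" using assms by (simp add: possemidef_def)
  have "0 \<le> (1 / (2 * d)) * ((d *\<^sub>R u - w) \<bullet> (A *v (d *\<^sub>R u - w)))"
    using assms by (simp add: possemidef_def)
  also have "\<dots> = d / 2 * (u \<bullet> (A *v u)) - u \<bullet> (A *v w) + 1 / (2 * d) * (w \<bullet> (A *v w))"
    using assms(2) unfolding form_diff[OF sym] form_scaleR inner_scaleR_left
    by (simp add: matrix_vector_mult_scaleR field_simps power2_eq_square)
  finally show ?thesis by simp
qed

lemma matrix_norm_bound:
  fixes A :: "real^'n^'m"
  shows "\<exists>K>0. \<forall>x. (A *v x) \<bullet> (A *v x) \<le> K * (x \<bullet> x)"
proof -
  obtain K where K: "K > 0" "\<And>x. norm (A *v x) \<le> norm x * K"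
    using bounded_linear.pos_bounded[OF matrix_vector_mul_bounded_linear[of A]] by auto
  have "(A *v x) \<bullet> (A *v x) \<le> K\<^sup>2 * (x \<bullet> x)" for x
    using power_mono[OF K(2)[of x], of 2]
    by (simp add: power_mult_distrib power2_norm_eq_inner mult.commute)
  with K(1) show ?thesis by (intro exI[of _ "K\<^sup>2"]) simp
qed

lemma diag_matrix_mult: "diag_matrix d *v x = (\<chi> i. d $ i * x $ i)"
  by (simp add: diag_matrix_def matrix_vector_mult_def vec_eq_iff if_distrib[where f="\<lambda>t. t * _"]
      cong: if_cong)

lemma transpose_diag_matrix: "transpose (diag_matrix d) = diag_matrix d"
  by (auto simp: transpose_def diag_matrix_def vec_eq_iff)

section \<open>The Laplacian and the averaging matrix\<close>

lemma laplacian_mult: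
  "(laplacian adj *v x) $ i = (\<Sum>j\<in>neighbors adj i. x $ i - x $ j)"
proof -
  have "(adjacency_matrix adj *v x) $ i = (\<Sum>j\<in>neighbors adj i. x $ j)"
    by (simp add: adjacency_matrix_def matrix_vector_mult_def neighbors_def
        if_distrib[where f="\<lambda>t. t * _"] sum.If_cases cong: if_cong)
  then show ?thesis
    by (simp add: laplacian_def degree_matrix_def matrix_vector_mult_diff_rdistrib diag_matrix_mult
        sum_subtractf)
qed

lemma transpose_laplacian: "simple_graph adj \<Longrightarrow> transpose (laplacian adj) = laplacian adj"
  unfolding laplacian_def degree_matrix_def transpose_diff transpose_diag_matrix
  by (auto simp: adjacency_matrix_def transpose_def simple_graph_def vec_eq_iff dest: sympD)

text \<open>Every edge is seen from both ends: adding the index-swapped copy of the double sum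
  completes the square.\<close>

lemma laplacian_form:
  assumes "simple_graph adj"
  shows "x \<bullet> (laplacian adj *v x) =
    (1/2) * (\<Sum>i\<in>UNIV. \<Sum>j\<in>UNIV. if adj i j then (x $ i - x $ j)\<^sup>2 else 0)"
proof -
  have adj: "adj i j = adj j i" for i j
    using assms by (auto simp: simple_graph_def dest: sympD)
  define T where "T = (\<Sum>i\<in>UNIV. \<Sum>j\<in>UNIV. if adj i j then x $ i * (x $ i - x $ j) else 0)"
  have T: "x \<bullet> (laplacian adj *v x) = T"
    by (simp add: inner_vec_def laplacian_mult T_def sum_distrib_left neighbors_def sum.If_cases)
  have "T = (\<Sum>i\<in>UNIV. \<Sum>j\<in>UNIV. if adj i j then x $ j * (x $ j - x $ i) else 0)"
    unfolding T_def by (subst sum.swap) (simp add: adj)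
  then have "T + T = T + (\<Sum>i\<in>UNIV. \<Sum>j\<in>UNIV. if adj i j then x $ j * (x $ j - x $ i) else 0)"
    by simp
  also have "\<dots> = (\<Sum>i\<in>UNIV. \<Sum>j\<in>UNIV. if adj i j then (x $ i - x $ j)\<^sup>2 else 0)"
    unfolding T_def sum.distrib[symmetric]
    by (intro sum.cong refl) (simp add: power2_eq_square algebra_simps)
  finally show ?thesis using T by simp
qed

text \<open>A vanishing sum of squares forces equal values across each edge, and paths carry the
  equality to all vertices.\<close>

lemma laplacian_form_zero_imp_constant:
  assumes "simple_graph adj" "connected_graph adj" "x \<bullet> (laplacian adj *v x) = 0"
  shows "x $ i = x $ j"
proof -
  have "(\<Sum>i\<in>UNIV. \<Sum>j\<in>UNIV. if adj i j then (x $ i - x $ j)\<^sup>2 else 0) = 0"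
    using assms by (simp add: laplacian_form)
  then have "\<forall>i j. (if adj i j then (x $ i - x $ j)\<^sup>2 else 0) = 0"
    by (simp add: sum_nonneg_eq_0_iff sum_nonneg)
  then have step: "x $ i = x $ j" if "adj i j" for i j 
    using that by (metis eq_iff_diff_eq_0 power_eq_0_iff)
  have "adj\<^sup>*\<^sup>* i j" using assms by (simp add: connected_graph_def)
  then show ?thesis by induction (auto dest: step)
qed

lemma laplacian_mult_one: "laplacian adj *v 1 = 0"
  by (simp add: vec_eq_iff laplacian_mult)

lemma averaging_matrix_mult:
  "averaging_matrix *v (x::real^'n) = ((1 \<bullet> x) / real CARD('n)) *\<^sub>R 1"
  by (simp add: averaging_matrix_def scaleR_mult_vec vec_eq_iff matrix_vector_mult_def
      matrix_matrix_mult_def columnvector_def rowvector_def inner_vec_def sum_divide_distrib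
      UNIV_1)

lemma transpose_averaging_matrix: "transpose averaging_matrix = (averaging_matrix :: real^'n^'n)"
  by (simp add: averaging_matrix_def transpose_scalar matrix_transpose_mul
      transpose_columnvector transpose_rowvector)

text \<open>By connectedness the Laplacian form vanishes only on constant vectors, and on nonzero
  constants the averaging term is positive.\<close>

lemma posdef_laplacian_averaging:
  fixes adj :: "'n::finite \<Rightarrow> 'n \<Rightarrow> bool"
  assumes "simple_graph adj" "connected_graph adj" "\<beta> > 0"
  shows "posdef (\<beta> *\<^sub>R laplacian adj + averaging_matrix)"
  unfolding posdef_def
proof (intro conjI allI impI)
  show "transpose (\<beta> *\<^sub>R laplacian adj + averaging_matrix) = \<beta> *\<^sub>R laplacian adj + averaging_matrix"
    by (simp add: transpose_add transpose_scalar transpose_laplacian[OF assms(1)]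
        transpose_averaging_matrix)
  fix x :: "real^'n" assume "x \<noteq> 0"
  have form: "x \<bullet> ((\<beta> *\<^sub>R laplacian adj + averaging_matrix) *v x) =
      \<beta> * (x \<bullet> (laplacian adj *v x)) + (1 \<bullet> x)\<^sup>2 / real CARD('n)"
    by (simp add: matrix_vector_mult_add_rdistrib scaleR_mult_vec averaging_matrix_mult
        inner_add_right inner_commute power2_eq_square)
  have nonneg: "x \<bullet> (laplacian adj *v x) \<ge> 0"
    by (simp add: laplacian_form[OF assms(1)] sum_nonneg)
  show "x \<bullet> ((\<beta> *\<^sub>R laplacian adj + averaging_matrix) *v x) > 0"
  proof (cases "x \<bullet> (laplacian adj *v x) = 0")
    case True
    define c where "c = x $ undefined"
    have "x $ i = c" for i
      using laplacian_form_zero_imp_constant[OF assms(1,2) True] by (simp add: c_def)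
    then have c: "x = c *\<^sub>R 1" by (simp add: vec_eq_iff)
    then have "c \<noteq> 0" using \<open>x \<noteq> 0\<close> by auto
    moreover have "1 \<bullet> x = c * real CARD('n)"
      unfolding c by (simp add: inner_vec_def)
    ultimately show ?thesis by (simp add: form True)
  next
    case False
    then show ?thesis using nonneg assms(3) by (simp add: form add_pos_nonneg)
  qed
qed

section \<open>One step of the algorithm\<close>

text \<open>Links the vector gradient in \<open>optimal_pair\<close> to the scalar derivatives used
  by the algorithm, through uniqueness of the derivative.\<close>

lemma GDERIV_objective:
  fixes f :: "'n::finite \<Rightarrow> real \<Rightarrow> real"
  assumes "\<And>i t. f i differentiable (at t)" and "GDERIV (objective f) x :> g"
  shows "g $ i = deriv (f i) (x $ i)"
proof -
  have d: "(f i has_real_derivative deriv (f i) t) (at t)" for i t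
    using assms(1) by (metis DERIV_deriv_iff_real_differentiable)
  have "((\<lambda>x. f i (x $ i)) has_derivative (\<lambda>h. deriv (f i) (x $ i) * h $ i)) (at x)" for i
    by (rule has_derivative_compose[OF bounded_linear.has_derivative[OF bounded_linear_vec_nth has_derivative_ident],
          of "f i" "\<lambda>h. deriv (f i) (x $ i) * h", simplified])
       (use d in \<open>auto simp: has_field_derivative_def\<close>)
  then have "(objective f has_derivative (\<lambda>h. \<Sum>i\<in>UNIV. deriv (f i) (x $ i) * h $ i)) (at x)"
    unfolding objective_def[abs_def] by (intro has_derivative_sum)
  then have "(\<lambda>h. h \<bullet> g) = (\<lambda>h. \<Sum>i\<in>UNIV. deriv (f i) (x $ i) * h $ i)"
    using assms(2) unfolding gderiv_def by (metis has_derivative_unique)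
  from fun_cong[OF this, of "axis i 1"] show ?thesis
    by (simp add: inner_axis') (simp add: axis_def if_distrib[where f="\<lambda>t. _ * t"] cong: if_cong)
qed

text \<open>Either the new value was just broadcast and the error is zero, or the trigger test
  failed, which is exactly the threshold bound. At \<open>k = 0\<close> the two sequences agree by
  initialization.\<close>

lemma broadcast_error:
  assumes "event_triggered_run adj f \<beta> \<eta> thr x xt z" and "\<And>i k. thr i k \<ge> 0"
  shows "\<bar>xt k $ i - x k $ i\<bar> \<le> max_threshold thr k"
proof -
  have "\<bar>xt k $ i - x k $ i\<bar> \<le> thr i k"
    using assms by (cases k) (auto simp: event_triggered_run_def abs_minus_commute)
  also have "\<dots> \<le> max_threshold thr k" by (simp add: max_threshold_def)
  finally show ?thesis .
qed

lemma inner_self_le_card: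
  fixes v :: "real^'n"
  assumes "\<And>i. \<bar>v $ i\<bar> \<le> E"
  shows "v \<bullet> v \<le> real CARD('n) * E\<^sup>2"
proof -
  have "v $ i * v $ i \<le> E\<^sup>2" for i
    using assms[of i] by (metis abs_le_square_iff abs_of_nonneg abs_ge_zero order_trans power2_eq_square)
  then show ?thesis
    using sum_bounded_above[of UNIV "\<lambda>i. v $ i * v $ i" "E\<^sup>2"] by (simp add: inner_vec_def)
qed

text \<open>Here \<open>a\<close>, \<open>b\<close> are the old and new primal errors and
  \<open>y\<close>, \<open>y'\<close> the preimages of the dual errors. Both energies are expanded
  around the new point; the coupling \<open>b \<bullet> (W *v y')\<close> arises once from each with
  opposite signs and cancels.\<close>

lemma energy_identity:
  fixes P W :: "real^'n^'n"
  assumes "transpose P = P" "transpose W = W"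
    and dual: "y' \<bullet> (W *v (y' - y)) = (W *v y') \<bullet> (b + e')"
    and primal: "P *v (a - b) = W *v y' + g + w"
  shows "a \<bullet> (P *v a) + y \<bullet> (W *v y) =
    b \<bullet> (P *v b) + y' \<bullet> (W *v y') + (a - b) \<bullet> (P *v (a - b)) + (y' - y) \<bullet> (W *v (y' - y))
    + 2 * (b \<bullet> g) + 2 * (b \<bullet> w) - 2 * (y' \<bullet> (W *v e'))"
proof -
  have "a \<bullet> (P *v a) = b \<bullet> (P *v b) + 2 * (b \<bullet> (P *v (a - b))) + (a - b) \<bullet> (P *v (a - b))"
    using form_add[OF assms(1), of b "a - b"] by simp
  moreover have "y \<bullet> (W *v y) = y' \<bullet> (W *v y') - 2 * (y' \<bullet> (W *v (y' - y))) + (y' - y) \<bullet> (W *v (y' - y))"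
    using form_diff[OF assms(2), of y' "y' - y"] by simp
  moreover have "b \<bullet> (P *v (a - b)) = b \<bullet> (W *v y') + b \<bullet> g + b \<bullet> w"
    by (simp add: primal inner_add_right)
  moreover have "y' \<bullet> (W *v (y' - y)) = b \<bullet> (W *v y') + y' \<bullet> (W *v e')"
    using symmetric_dot[OF assms(2), of y' e'] by (simp add: dual inner_add_right inner_commute)
  ultimately show ?thesis by simp
qed

theorem theorem2:
  fixes adj :: "'n::finite \<Rightarrow> 'n \<Rightarrow> bool"
    and f :: "'n \<Rightarrow> real \<Rightarrow> real"
    and \<beta> k1 k2 k3 k4 :: real
    and \<eta> lf \<mu> :: "real^'n"
    and thr :: "'n \<Rightarrow> nat \<Rightarrow> real"
    and x xt z :: "nat \<Rightarrow> real^'n"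
    and xs ys zs :: "real^'n"
    and S L H Lf M P Q W :: "real^'n^'n"
  assumes graph: "simple_graph adj" "connected_graph adj"
    and L: "L = laplacian adj"
    and S: "is_psd_sqrt S L"
    and beta: "\<beta> > 0"
    and H: "H = diag_matrix \<eta>" "posdef H"
    and thr_nonneg: "\<And>i k. thr i k \<ge> 0"
    and thr_decseq: "decseq (max_threshold thr)"
    and thr_summable: "summable (max_threshold thr)"
    and f_convex: "\<And>i. convex_on UNIV (f i)"
    and f_diff: "\<And>i t. f i differentiable (at t)"
    and lf_pos: "\<And>i. lf $ i > 0"
    and f_lipschitz: "\<And>i s t. \<bar>deriv (f i) s - deriv (f i) t\<bar> \<le> lf $ i * \<bar>s - t\<bar>"
    and mu_pos: "\<And>i. \<mu> $ i > 0"
    and f_strongly_convex: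
      "\<And>i s t. (deriv (f i) s - deriv (f i) t) * (s - t) \<ge> \<mu> $ i * \<bar>s - t\<bar>\<^sup>2"
    and Lf: "Lf = diag_matrix lf"
    and M: "M = diag_matrix \<mu>"
    and P: "P = H - \<beta> *\<^sub>R L"
    and k1: "0 < k1" "k1 < 2 * lambda_min M"
    and P_posdef: "posdef (P - (1 / k1) *\<^sub>R (Lf ** Lf))"
    and Q: "Q = 2 *\<^sub>R M - k1 *\<^sub>R mat 1"
    and W: "W = \<beta> *\<^sub>R L + averaging_matrix"
    and run: "event_triggered_run adj f \<beta> \<eta> thr x xt z"
    and opt: "optimal_pair f S xs ys"
    and zs: "zs = S *v ys"
    and k2: "0 < k2" and k3: "2 < k3" and k4: "0 < k4" "k4 < 1"
  shows "\<exists>k5_max>0. \<forall>k5. 0 < k5 \<and> k5 < k5_max \<longrightarrow>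
    (\<exists>\<sigma>>0. \<forall>k.
      1/2 * (wnorm (P + k4 *\<^sub>R Q) (x k - xs))\<^sup>2
      + 1/2 * (wnorm (matrix_inv W) (z k - zs))\<^sup>2
      + real CARD('n) * error_const \<beta> L (P + k4 *\<^sub>R Q) k2 k3 k5 \<sigma> * (max_threshold thr k)\<^sup>2
      \<ge> (\<sigma> + 1) / 2 *
          ((wnorm (P + k4 *\<^sub>R Q) (x (Suc k) - xs))\<^sup>2
           + (wnorm (matrix_inv W) (zs - z (Suc k)))\<^sup>2))"
proof -
  let ?n = "real CARD('n)"
  let ?E = "max_threshold thr"

  \<comment> \<open>Weights, spectral constants and forms\<close>
  define R where "R = P + k4 *\<^sub>R Q"
  \<comment> \<open>What remains of \<open>P\<close> after paying the Lipschitz cost of evaluating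
    the gradient at the old iterate.\<close>
  define P' where "P' = P - (1 / k1) *\<^sub>R (Lf ** Lf)"
  define \<omega> where "\<omega> = lambda_min W"
  define \<Lambda> where "\<Lambda> = lambda_max (\<beta>\<^sup>2 *\<^sub>R (L ** L))"
  define q where "q = 2 * lambda_min M - k1"
  define p where "p = lambda_min P'"
  define \<rho> where "\<rho> = lambda_min R"

  have symL: "transpose L = L" using graph by (simp add: L transpose_laplacian)
  have symH: "transpose H = H" by (simp add: H transpose_diag_matrix)
  have symM: "transpose M = M" by (simp add: M transpose_diag_matrix)
  have symLf: "transpose Lf = Lf" by (simp add: Lf transpose_diag_matrix)
  have symP: "transpose P = P" by (simp add: P transpose_diff transpose_scalar symL symH)
  have symQ: "transpose Q = Q" by (simp add: Q transpose_diff transpose_scalar symM)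
  have symR: "transpose R = R" by (simp add: R_def transpose_add transpose_scalar symP symQ)
  have symLL: "transpose (\<beta>\<^sup>2 *\<^sub>R (L ** L)) = \<beta>\<^sup>2 *\<^sub>R (L ** L)"
    by (simp add: transpose_scalar matrix_transpose_mul symL)
  have W_pd: "posdef W" unfolding W L using graph beta by (rule posdef_laplacian_averaging)
  then have symW: "transpose W = W" and W_psd: "possemidef W"
    by (simp_all add: posdef_def posdef_imp_possemidef)

  have q: "q > 0" using k1 by (simp add: q_def)
  have p: "p > 0" using P_posdef by (simp add: p_def P'_def lambda_min_pos)
  have \<omega>: "\<omega> > 0" using W_pd by (simp add: \<omega>_def lambda_min_pos)

  have formQ: "u \<bullet> (Q *v u) = 2 * (u \<bullet> (M *v u)) - k1 * (u \<bullet> u)" for u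
    by (simp add: Q matrix_vector_mult_diff_rdistrib scaleR_mult_vec inner_diff_right)
  have formP: "u \<bullet> (P *v u) = u \<bullet> (P' *v u) + (1 / k1) * ((Lf *v u) \<bullet> (Lf *v u))" for u
    using symmetric_dot[OF symLf, of u "Lf *v u"]
    by (simp add: P'_def matrix_vector_mult_diff_rdistrib scaleR_mult_vec inner_diff_right
        matrix_vector_mul_assoc[symmetric])
  have formR: "u \<bullet> (R *v u) = u \<bullet> (P *v u) + k4 * (u \<bullet> (Q *v u))" for u
    by (simp add: R_def matrix_vector_mult_add_rdistrib scaleR_mult_vec inner_add_right)
  have formLL: "(\<beta> *\<^sub>R (L *v u)) \<bullet> (\<beta> *\<^sub>R (L *v u)) = u \<bullet> ((\<beta>\<^sup>2 *\<^sub>R (L ** L)) *v u)" for u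
    using symmetric_dot[OF symL, of u "L *v u"]
    by (simp add: scaleR_mult_vec matrix_vector_mul_assoc[symmetric] power2_eq_square)
  have Q_ge: "q * (u \<bullet> u) \<le> u \<bullet> (Q *v u)" for u
    using lambda_min_le[OF symM, of u] by (simp add: formQ q_def algebra_simps)
  have P'_ge: "p * (u \<bullet> u) \<le> u \<bullet> (P' *v u)" for u
    using P_posdef lambda_min_le[of P' u] by (simp add: p_def P'_def posdef_def)
  have R_pd: "posdef R"
    unfolding posdef_def
  proof (intro conjI allI impI)
    fix u :: "real^'n" assume "u \<noteq> 0"
    then have "u \<bullet> u > 0" by simp
    then have "p * (u \<bullet> u) > 0" "q * (u \<bullet> u) > 0" using p q by simp_all
    then have "u \<bullet> (P' *v u) > 0" "k4 * (u \<bullet> (Q *v u)) > 0"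
      using P'_ge[of u] Q_ge[of u] k4 by simp_all
    moreover have "(1 / k1) * ((Lf *v u) \<bullet> (Lf *v u)) \<ge> 0" using k1 by simp
    ultimately show "u \<bullet> (R *v u) > 0" unfolding formR formP by linarith
  qed (rule symR)
  have \<rho>: "\<rho> > 0" using R_pd by (simp add: \<rho>_def lambda_min_pos)
  have R_ge: "\<rho> * (u \<bullet> u) \<le> u \<bullet> (R *v u)" for u
    unfolding \<rho>_def by (rule lambda_min_le[OF symR])

  \<comment> \<open>The all-ones vector serves as a nonzero test vector from which the signs of
    largest eigenvalues are read off.\<close>
  have one_pos: "0 < 1 \<bullet> (1::real^'n)" by (simp add: inner_vec_def)
  define r where "r = lambda_max R"
  have R_le: "u \<bullet> (R *v u) \<le> r * (u \<bullet> u)" for u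
    unfolding r_def by (rule lambda_max_ge[OF symR])
  have r: "r > 0"
  proof -
    have "0 < \<rho> * (1 \<bullet> (1::real^'n))" using \<rho> one_pos by (rule mult_pos_pos)
    also have "\<dots> \<le> r * (1 \<bullet> (1::real^'n))" using R_ge R_le by (rule order_trans)
    finally show ?thesis using one_pos by (rule zero_less_mult_pos2)
  qed

  \<comment> \<open>Splitting weights and the total margin \<open>s\<close>\<close>
  obtain KP where KP: "KP > 0" "\<And>u. (P *v u) \<bullet> (P *v u) \<le> KP * (u \<bullet> u)"
    using matrix_norm_bound[of P] by blast
  obtain KL where KL: "KL > 0" "\<And>u. (Lf *v u) \<bullet> (Lf *v u) \<le> KL * (u \<bullet> u)"
    using matrix_norm_bound[of Lf] by blast

  text \<open>Any splitting weight \<open>c > 1\<close> for the error term would do; this one reproduces the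
    constant of the statement, whose first term is proportional to \<open>\<sigma> + k\<^sub>5 = s\<close>.\<close>
  define c where "c = (k3 + 1 / k2 - 1) / (1 - 2 / k3)"
  have c: "c > 1"
  proof -
    define t u where "t = 2 / k3" and "u = 1 / k2"
    have "0 < t" "t < 1" "0 < u" using k2 k3 by (simp_all add: t_def u_def)
    then have "0 < 1 - t" "1 - t < k3 + u - 1" using k3 by linarith+
    then have "0 < 1 - 2 / k3" "1 - 2 / k3 < k3 + 1 / k2 - 1" unfolding t_def u_def .
    then show ?thesis unfolding c_def by (simp only: less_divide_eq_1_pos)
  qed
  \<comment> \<open>The weight that \<open>norm_add_square_le\<close> with \<open>d = c - 1\<close>
    puts on the other summand.\<close>
  define K where "K = 1 + 1 / (c - 1)"
  have K: "K > 0" using c by (simp add: K_def add_pos_pos)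
  \<comment> \<open>The first cap lets \<open>(1 - k4) * q\<close> absorb the new primal energy. The
    other two let \<open>p\<close> and \<open>k4 * q\<close> absorb the new dual energy, once it is
    bounded through the step equation.\<close>
  define s where "s = Min {(1 - k4) * q / r, p * \<omega> / (2 * K * KP), k4 * q * \<omega> / (2 * K * KL)}"
  have s: "s > 0" using k4 q r p \<omega> K KP KL by (simp add: s_def)
  have s_r: "s * r \<le> (1 - k4) * q"
  proof -
    have "s \<le> (1 - k4) * q / r" by (simp add: s_def)
    then show ?thesis using r by (simp add: pos_le_divide_eq)
  qed
  have s_P: "s / \<omega> * (2 * K * KP) \<le> p"
  proof -
    have "s \<le> p * \<omega> / (2 * K * KP)" by (simp add: s_def)
    then have "s * (2 * K * KP) \<le> p * \<omega>" using K KP by (subst (asm) pos_le_divide_eq) simp_all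
    then show ?thesis using \<omega> by (simp add: pos_divide_le_eq)
  qed
  have s_L: "s / \<omega> * (2 * K * KL) \<le> k4 * q"
  proof -
    have "s \<le> k4 * q * \<omega> / (2 * K * KL)" by (simp add: s_def)
    then have "s * (2 * K * KL) \<le> k4 * q * \<omega>" using K KL by (subst (asm) pos_le_divide_eq) simp_all
    then show ?thesis using \<omega> by (simp add: pos_divide_le_eq)
  qed

  \<comment> \<open>Gradient estimates and optimality conditions\<close>
  define G where "G u = (\<chi> i. deriv (f i) (u $ i))" for u :: "real^'n"
  have G_lip: "(G u - G v) \<bullet> (G u - G v) \<le> (Lf *v (u - v)) \<bullet> (Lf *v (u - v))" for u v
    unfolding inner_vec_def
  proof (rule sum_mono)
    fix i
    have "\<bar>(G u - G v) $ i\<bar> \<le> \<bar>(Lf *v (u - v)) $ i\<bar>"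
      using f_lipschitz[of i "u $ i" "v $ i"] lf_pos[of i]
      by (simp add: G_def Lf diag_matrix_mult abs_mult)
    then show "(G u - G v) $ i \<bullet> (G u - G v) $ i \<le> (Lf *v (u - v)) $ i \<bullet> (Lf *v (u - v)) $ i"
      by (simp add: abs_le_square_iff power2_eq_square)
  qed
  have G_mono: "(u - v) \<bullet> (M *v (u - v)) \<le> (u - v) \<bullet> (G u - G v)" for u v
    unfolding inner_vec_def
  proof (rule sum_mono)
    fix i
    show "(u - v) $ i \<bullet> (M *v (u - v)) $ i \<le> (u - v) $ i \<bullet> (G u - G v) $ i"
      using f_strongly_convex[of i "u $ i" "v $ i"]
      by (simp add: G_def M diag_matrix_mult power2_eq_square mult_ac)
  qed

  from opt obtain g where g: "GDERIV (objective f) xs :> g" "g + S *v ys = 0" and Sxs: "S *v xs = 0"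
    by (auto simp: optimal_pair_def)
  have "g = G xs" using GDERIV_objective[OF f_diff g(1)] by (simp add: G_def vec_eq_iff)
  with g(2) have Gxs: "G xs + zs = 0" by (simp add: zs)
  have L_S: "L *v u = S *v (S *v u)" for u
    using S by (auto simp: is_psd_sqrt_def matrix_vector_mul_assoc)
  have symS: "transpose S = S" using S by (simp add: is_psd_sqrt_def possemidef_def)
  have Lxs: "L *v xs = 0" by (simp add: L_S Sxs)
  have L1: "L *v 1 = 0" by (simp add: L laplacian_mult_one)
  \<comment> \<open>The squared length of \<open>S *v 1\<close> is
    \<open>1 \<bullet> (L *v 1)\<close>, which is zero.\<close>
  have S1: "S *v 1 = 0"
    using symmetric_dot[OF symS, of 1 "S *v 1"] by (simp add: L_S[symmetric] L1)
  have one_L: "1 \<bullet> (L *v u) = 0" for u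
    using symmetric_dot[OF symL, of 1 u] by (simp add: L1)
  have one_zs: "1 \<bullet> zs = 0"
    using symmetric_dot[OF symS, of 1 ys] by (simp add: S1 zs)

  \<comment> \<open>The run in matrix form\<close>
  define e where "e k = xt k - x k" for k
  have xt: "xt k = x k + e k" for k by (simp add: e_def)
  have xt_sum: "(L *v xt k) $ i = (\<Sum>j\<in>neighbors adj i. xt k $ i - xt k $ j)" for k i
    by (simp add: L laplacian_mult)
  have z0: "z 0 = 0" using run by (simp add: event_triggered_run_def)
  have z_step: "z (Suc k) = z k + \<beta> *\<^sub>R (L *v xt (Suc k))" for k
    using run by (simp add: vec_eq_iff event_triggered_run_def xt_sum)
  have x_step: "H *v (x k - x (Suc k)) = z k + G (x k) + \<beta> *\<^sub>R (L *v xt k)" for k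
  proof -
    \<comment> \<open>Multiplying the update by \<open>H\<close> undoes the division by
      \<open>\<eta> $ i\<close>; testing definiteness on basis vectors shows these entries to be
      nonzero.\<close>
    have "\<eta> $ i \<noteq> 0" for i
    proof -
      have "axis i 1 \<bullet> (H *v axis i 1) > 0" using H(2) by (simp add: posdef_def axis_eq_0_iff)
      then show ?thesis by (auto simp: H diag_matrix_mult inner_axis')
    qed
    then show ?thesis
      using run by (simp add: vec_eq_iff event_triggered_run_def xt_sum H diag_matrix_mult G_def)
  qed
  \<comment> \<open>The multiplier starts at zero and only gains vectors in the range of
    \<open>L\<close>, which are orthogonal to \<open>1\<close>.\<close>
  have one_z: "1 \<bullet> z k = 0" for k
    by (induction k) (simp_all add: z0 z_step inner_add_right one_L)
  have thr_mono: "?E (Suc k) \<le> ?E k" for k using thr_decseq by (simp add: decseq_Suc_iff)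
  have e_le: "\<bar>e k $ i\<bar> \<le> ?E k" for k i
    using broadcast_error[OF run thr_nonneg] by (simp add: e_def)

  \<comment> \<open>The one-step energy inequality\<close>
  have step: "1/2 * (wnorm R (x k - xs))\<^sup>2 + 1/2 * (wnorm (matrix_inv W) (z k - zs))\<^sup>2
      + ?n * error_const \<beta> L R k2 k3 k5 \<sigma> * (?E k)\<^sup>2
      \<ge> (\<sigma> + 1) / 2 * ((wnorm R (x (Suc k) - xs))\<^sup>2 + (wnorm (matrix_inv W) (zs - z (Suc k)))\<^sup>2)"
    if k5: "k5 > 0" and \<sigma>: "\<sigma> + k5 = s" for k k5 \<sigma>
  proof -
    define a where "a = x k - xs"
    define b where "b = x (Suc k) - xs"
    define e' where "e' = e (Suc k)"
    define w where "w = \<beta> *\<^sub>R (L *v (e k - e'))"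
    define y where "y = matrix_inv W *v (z k - zs)"
    define y' where "y' = matrix_inv W *v (z (Suc k) - zs)"
    define N where "N = ?n * (?E k)\<^sup>2"
    have Wy: "W *v y = z k - zs" and Wy': "W *v y' = z (Suc k) - zs"
      using posdef_mult_matrix_inv[OF W_pd] by (simp_all add: y_def y'_def)

    \<comment> \<open>The error at step \<open>Suc k\<close> is charged to the threshold at step
      \<open>k\<close>, which is where monotonicity of the thresholds enters.\<close>
    have e'_le: "e' \<bullet> e' \<le> N"
      unfolding N_def e'_def using e_le[of "Suc k"] thr_mono[of k]
      by (intro inner_self_le_card) (meson order_trans)
    have "(e k - e') \<bullet> (e k - e') \<le> ?n * (2 * ?E k)\<^sup>2"
    proof (rule inner_self_le_card)
      fix i show "\<bar>(e k - e') $ i\<bar> \<le> 2 * ?E k"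
        using e_le[of k i] e_le[of "Suc k" i] thr_mono[of k] by (simp add: e'_def)
    qed
    then have d_le: "(e k - e') \<bullet> (e k - e') \<le> 4 * N" by (simp add: N_def power_mult_distrib)
    have \<Lambda>: "\<Lambda> \<ge> 0"
    proof -
      have "0 \<le> (1::real^'n) \<bullet> ((\<beta>\<^sup>2 *\<^sub>R (L ** L)) *v 1)" by (simp only: formLL[symmetric] inner_ge_zero)
      also have "\<dots> \<le> \<Lambda> * (1 \<bullet> (1::real^'n))" unfolding \<Lambda>_def by (rule lambda_max_ge[OF symLL])
      finally show ?thesis using one_pos by (meson mult_neg_pos not_le)
    qed
    have w_le: "w \<bullet> w \<le> 4 * \<Lambda> * N"
    proof -
      have "w \<bullet> w \<le> \<Lambda> * ((e k - e') \<bullet> (e k - e'))"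
        unfolding w_def formLL \<Lambda>_def by (rule lambda_max_ge[OF symLL])
      also have "\<dots> \<le> \<Lambda> * (4 * N)" using d_le \<Lambda> by (rule mult_left_mono)
      finally show ?thesis by simp
    qed
    have We'_le: "e' \<bullet> (W *v e') \<le> lambda_max W * N"
    proof -
      have "e' \<bullet> (W *v e') \<le> lambda_max W * (e' \<bullet> e')" by (rule lambda_max_ge[OF symW])
      also have "\<dots> \<le> lambda_max W * N"
      proof (rule mult_left_mono[OF e'_le])
        have "0 \<le> (1::real^'n) \<bullet> (W *v 1)" using W_psd by (simp add: possemidef_def)
        also have "\<dots> \<le> lambda_max W * (1 \<bullet> (1::real^'n))" by (rule lambda_max_ge[OF symW])
        finally show "0 \<le> lambda_max W" using one_pos by (meson mult_neg_pos not_le)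
      qed
      finally show ?thesis .
    qed

    \<comment> \<open>Substituting the update of \<open>z\<close> turns \<open>z k\<close> into
      \<open>z (Suc k)\<close>, leaving only the difference of broadcast errors; optimality replaces
      \<open>G xs\<close> by \<open>- zs\<close>.\<close>
    have primal: "P *v (a - b) = W *v y' + (G (x k) - G xs) + w"
    proof -
      have "P *v (a - b) = H *v (x k - x (Suc k)) - \<beta> *\<^sub>R (L *v (x k - x (Suc k)))"
        by (simp add: a_def b_def P matrix_vector_mult_diff_rdistrib scaleR_mult_vec)
      then show ?thesis
        unfolding x_step Wy' z_step xt w_def e'_def eq_neg_iff_add_eq_0[THEN iffD2, OF Gxs]
        by (simp add: matrix_vector_right_distrib matrix_vector_mult_diff_distrib algebra_simps)
    qed
    \<comment> \<open>The dual increment is \<open>W *v (b + e')\<close> minus its averaging part.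
      As \<open>W\<close> fixes \<open>1\<close>, the vector \<open>y'\<close> inherits mean zero
      from \<open>z (Suc k) - zs\<close> and does not see that part.\<close>
    have dual: "y' \<bullet> (W *v (y' - y)) = (W *v y') \<bullet> (b + e')"
    proof -
      have "W *v (y' - y) = \<beta> *\<^sub>R (L *v xt (Suc k))"
        by (simp add: matrix_vector_mult_diff_distrib Wy Wy' z_step)
      also have "\<dots> = \<beta> *\<^sub>R (L *v (b + e'))"
        by (simp add: xt b_def e'_def matrix_vector_right_distrib matrix_vector_mult_diff_distrib Lxs)
      also have "\<dots> = W *v (b + e') - averaging_matrix *v (b + e')"
        by (simp add: W matrix_vector_mult_add_rdistrib scaleR_mult_vec)
      finally have "y' \<bullet> (W *v (y' - y)) = y' \<bullet> (W *v (b + e')) - y' \<bullet> (averaging_matrix *v (b + e'))"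
        by (simp add: inner_diff_right)
      moreover have "1 \<bullet> y' = 0"
      proof -
        have "W *v 1 = 1"
          by (simp add: W matrix_vector_mult_add_rdistrib scaleR_mult_vec L1 averaging_matrix_mult inner_vec_def)
        then have "1 \<bullet> y' = 1 \<bullet> (W *v y')" using symmetric_dot[OF symW, of 1 y'] by simp
        then show ?thesis by (simp add: Wy' inner_diff_right one_z one_zs)
      qed
      ultimately show ?thesis
        by (simp add: averaging_matrix_mult symmetric_dot[OF symW] inner_commute[of y' 1])
    qed

    \<comment> \<open>Strong convexity wants the gradient at \<open>x (Suc k)\<close>, but the step
      uses the one at \<open>x k\<close>. The difference \<open>h\<close> is split off with weight
      \<open>k1\<close>; its share in \<open>b\<close> turns \<open>2 *\<^sub>R M\<close> into
      \<open>Q\<close>.\<close>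
    have grad: "2 * (b \<bullet> (G (x k) - G xs)) \<ge> b \<bullet> (Q *v b) - (1 / k1) * ((Lf *v (a - b)) \<bullet> (Lf *v (a - b)))"
    proof -
      define h where "h = G (x (Suc k)) - G (x k)"
      have "b \<bullet> (G (x k) - G xs) = b \<bullet> (G (x (Suc k)) - G xs) - b \<bullet> h"
        by (simp add: h_def inner_diff_right)
      moreover have "b \<bullet> (M *v b) \<le> b \<bullet> (G (x (Suc k)) - G xs)" unfolding b_def by (rule G_mono)
      moreover have "b \<bullet> h \<le> k1 / 2 * (b \<bullet> b) + 1 / (2 * k1) * (h \<bullet> h)"
        using k1(1) by (rule inner_le_weighted)
      moreover have "h \<bullet> h \<le> (Lf *v (a - b)) \<bullet> (Lf *v (a - b))"
      proof -
        have "x (Suc k) - x k = - (a - b)" by (simp add: a_def b_def)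
        then have "Lf *v (x (Suc k) - x k) = - (Lf *v (a - b))"
          by (metis matrix_vector_mult_diff_distrib minus_diff_eq)
        then show ?thesis using G_lip[of "x (Suc k)" "x k"] by (simp add: h_def)
      qed
      then have "1 / (2 * k1) * (h \<bullet> h) \<le> 1 / (2 * k1) * ((Lf *v (a - b)) \<bullet> (Lf *v (a - b)))"
        using k1 by (intro mult_left_mono) auto
      ultimately show ?thesis unfolding formQ by simp
    qed

    \<comment> \<open>The weight \<open>k5 * \<rho>\<close> makes the quadratic share in
      \<open>b\<close> at most \<open>k5 / 2\<close> of the new primal energy.\<close>
    have bw: "- (b \<bullet> w) \<le> k5 / 2 * (b \<bullet> (R *v b)) + 2 * \<Lambda> / (k5 * \<rho>) * N"
    proof -
      have "b \<bullet> (- w) \<le> (k5 * \<rho>) / 2 * (b \<bullet> b) + 1 / (2 * (k5 * \<rho>)) * ((- w) \<bullet> (- w))"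
        using k5 \<rho> by (intro inner_le_weighted) simp
      moreover have "k5 / 2 * (\<rho> * (b \<bullet> b)) \<le> k5 / 2 * (b \<bullet> (R *v b))"
        using k5 R_ge by (intro mult_left_mono) auto
      moreover have "1 / (2 * (k5 * \<rho>)) * (w \<bullet> w) \<le> 1 / (2 * (k5 * \<rho>)) * (4 * \<Lambda> * N)"
        using k5 \<rho> w_le by (intro mult_left_mono) auto
      moreover have "1 / (2 * (k5 * \<rho>)) * (4 * \<Lambda> * N) = 2 * \<Lambda> / (k5 * \<rho>) * N"
        by (simp add: mult_ac)
      moreover have "k5 / 2 * (\<rho> * (b \<bullet> b)) = (k5 * \<rho>) / 2 * (b \<bullet> b)" by simp
      ultimately show ?thesis unfolding inner_minus_right inner_minus_left minus_minus by linarith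
    qed
    have ye: "y' \<bullet> (W *v e') \<le> k5 / 2 * (y' \<bullet> (W *v y')) + lambda_max W / (2 * k5) * N"
    proof -
      have "y' \<bullet> (W *v e') \<le> k5 / 2 * (y' \<bullet> (W *v y')) + 1 / (2 * k5) * (e' \<bullet> (W *v e'))"
        using W_psd k5 by (rule form_le_weighted)
      also have "\<dots> \<le> k5 / 2 * (y' \<bullet> (W *v y')) + 1 / (2 * k5) * (lambda_max W * N)"
        using We'_le k5 by (intro add_left_mono mult_left_mono) auto
      finally show ?thesis by simp
    qed

    \<comment> \<open>The step equation gives \<open>W *v y' = u - w\<close>. Weight
      \<open>c\<close> goes to the error \<open>w\<close>, weight \<open>K\<close> to
      \<open>u\<close>, whose two parts are controlled by \<open>a - b\<close> and by
      \<open>a\<close>. The caps on \<open>s\<close> then fit these into the \<open>P'\<close> and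
      \<open>Q\<close> surplus.\<close>
    have dual_le: "s * (y' \<bullet> (W *v y')) \<le>
        (a - b) \<bullet> (P' *v (a - b)) + k4 * (a \<bullet> (Q *v a)) + s / \<omega> * (c * (4 * \<Lambda> * N))"
    proof -
      define v h where "v = P *v (a - b)" and "h = G (x k) - G xs"
      define u where "u = v - h"
      have "h \<bullet> h \<le> KL * (a \<bullet> a)"
        unfolding h_def a_def using G_lip KL(2) by (rule order_trans)
      moreover have "v \<bullet> v \<le> KP * ((a - b) \<bullet> (a - b))" unfolding v_def by (rule KP)
      moreover have "u \<bullet> u \<le> 2 * (v \<bullet> v) + 2 * (h \<bullet> h)"
        using norm_add_square_le[of 1 v "- h"] by (simp add: u_def)
      ultimately have "u \<bullet> u \<le> 2 * KP * ((a - b) \<bullet> (a - b)) + 2 * KL * (a \<bullet> a)"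
        by linarith
      then have "K * (u \<bullet> u) \<le> K * (2 * KP * ((a - b) \<bullet> (a - b)) + 2 * KL * (a \<bullet> a))"
        using K by (intro mult_left_mono) auto
      moreover have "c * (w \<bullet> w) \<le> c * (4 * \<Lambda> * N)" using c w_le by (intro mult_left_mono) auto
      moreover have "\<omega> * (y' \<bullet> (W *v y')) \<le> (W *v y') \<bullet> (W *v y')"
        unfolding \<omega>_def by (rule lambda_min_form_le_norm[OF W_pd])
      moreover have "W *v y' = u + - w" by (simp add: u_def v_def h_def primal)
      moreover have "(u + - w) \<bullet> (u + - w) \<le> K * (u \<bullet> u) + c * (w \<bullet> w)"
        using norm_add_square_le[of "c - 1" u "- w"] c by (simp add: K_def)
      ultimately have "\<omega> * (y' \<bullet> (W *v y')) \<le>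
          2 * K * KP * ((a - b) \<bullet> (a - b)) + 2 * K * KL * (a \<bullet> a) + c * (4 * \<Lambda> * N)"
        by (simp add: distrib_left mult_ac)
      then have "s / \<omega> * (\<omega> * (y' \<bullet> (W *v y'))) \<le> s / \<omega> *
          (2 * K * KP * ((a - b) \<bullet> (a - b)) + 2 * K * KL * (a \<bullet> a) + c * (4 * \<Lambda> * N))"
        using s \<omega> by (intro mult_left_mono) auto
      also have "\<dots> = s / \<omega> * (2 * K * KP) * ((a - b) \<bullet> (a - b)) + s / \<omega> * (2 * K * KL) * (a \<bullet> a)
          + s / \<omega> * (c * (4 * \<Lambda> * N))"
        by (simp only: distrib_left mult.assoc)
      also have "\<dots> \<le> p * ((a - b) \<bullet> (a - b)) + k4 * q * (a \<bullet> a) + s / \<omega> * (c * (4 * \<Lambda> * N))"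
        using s_P s_L by (intro add_mono mult_right_mono order_refl) auto
      also have "\<dots> \<le> (a - b) \<bullet> (P' *v (a - b)) + k4 * (a \<bullet> (Q *v a)) + s / \<omega> * (c * (4 * \<Lambda> * N))"
        unfolding mult.assoc[of k4] using P'_ge Q_ge k4
        by (intro add_mono mult_left_mono order_refl) auto
      finally show ?thesis using \<omega> by simp
    qed
    have primal_le: "s * (b \<bullet> (R *v b)) \<le> (1 - k4) * (b \<bullet> (Q *v b))"
    proof -
      have "s * (b \<bullet> (R *v b)) \<le> s * (r * (b \<bullet> b))" using s R_le by (intro mult_left_mono) auto
      also have "\<dots> \<le> (1 - k4) * q * (b \<bullet> b)"
        using s_r by (simp add: mult.assoc[symmetric] mult_right_mono)
      also have "\<dots> \<le> (1 - k4) * (b \<bullet> (Q *v b))"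
        unfolding mult.assoc[of "1 - k4"] using Q_ge k4 by (intro mult_left_mono) auto
      finally show ?thesis .
    qed

    define EC where "EC = error_const \<beta> L R k2 k3 k5 \<sigma>"
    \<comment> \<open>The first term carries half of the error in \<open>dual_le\<close>, because
      the final claim is stated with halved energies.\<close>
    have EC: "N * EC = s / \<omega> * (c * (2 * \<Lambda> * N)) + lambda_max W / (2 * k5) * N + 2 * \<Lambda> / (k5 * \<rho>) * N"
    proof -
      have "2 * (k3 + 1 / k2 - 1) * s * \<Lambda> / ((1 - 2 / k3) * \<omega>) = s / \<omega> * (c * (2 * \<Lambda>))"
        unfolding c_def by (simp only: times_divide_eq_left times_divide_eq_right divide_divide_eq_left mult_ac)
      then have "EC = s / \<omega> * (c * (2 * \<Lambda>)) + lambda_max W / (2 * k5) + 2 * \<Lambda> / (k5 * \<rho>)"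
        unfolding EC_def error_const_def \<sigma> W[symmetric] \<Lambda>_def[symmetric] \<omega>_def[symmetric] \<rho>_def[symmetric]
        by simp
      then show ?thesis by (simp only: distrib_left mult_ac)
    qed
    have energy: "a \<bullet> (P *v a) + y \<bullet> (W *v y) =
        b \<bullet> (P *v b) + y' \<bullet> (W *v y') + (a - b) \<bullet> (P *v (a - b)) + (y' - y) \<bullet> (W *v (y' - y))
        + 2 * (b \<bullet> (G (x k) - G xs)) + 2 * (b \<bullet> w) - 2 * (y' \<bullet> (W *v e'))"
      using symP symW dual primal by (rule energy_identity)
    have "(y' - y) \<bullet> (W *v (y' - y)) \<ge> 0" using W_psd by (simp add: possemidef_def)
    have fin: "(\<sigma> + 1) * (b \<bullet> (R *v b) + y' \<bullet> (W *v y')) \<le>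
        a \<bullet> (R *v a) + y \<bullet> (W *v y) + 2 * (N * EC)"
    proof -
      \<comment> \<open>Naming the products makes the remaining argument linear. Of the gain
        \<open>s\<close> on the new energy, the share \<open>k5\<close> pays for the error couplings
        \<open>bw\<close> and \<open>ye\<close>, and \<open>\<sigma>\<close> is left.\<close>
      define bR yW where "bR = b \<bullet> (R *v b)" and "yW = y' \<bullet> (W *v y')"
      define T1 T2 T3 where "T1 = s / \<omega> * (c * (2 * \<Lambda> * N))"
        and "T2 = lambda_max W / (2 * k5) * N" and "T3 = 2 * \<Lambda> / (k5 * \<rho>) * N"
      define kb ky sb sy where "kb = k5 * bR" and "ky = k5 * yW" and "sb = s * bR" and "sy = s * yW"
      define qa qb qd where "qa = k4 * (a \<bullet> (Q *v a))" and "qb = k4 * (b \<bullet> (Q *v b))"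
        and "qd = (1 / k1) * ((Lf *v (a - b)) \<bullet> (Lf *v (a - b)))"
      have "(\<sigma> + 1) * (bR + yW) = bR + yW + sb + sy - kb - ky"
        by (simp add: \<sigma>[symmetric] sb_def sy_def kb_def ky_def algebra_simps)
      moreover have "sb \<le> b \<bullet> (Q *v b) - qb"
        using primal_le by (simp add: sb_def bR_def qb_def left_diff_distrib)
      moreover have "sy \<le> (a - b) \<bullet> (P' *v (a - b)) + qa + 2 * T1"
        using dual_le by (simp add: sy_def yW_def qa_def T1_def mult_ac)
      moreover have "- (b \<bullet> w) \<le> kb / 2 + T3"
        using bw by (simp add: kb_def bR_def T3_def)
      moreover have "y' \<bullet> (W *v e') \<le> ky / 2 + T2"
        using ye by (simp add: ky_def yW_def T2_def)
      moreover have "(a - b) \<bullet> (P *v (a - b)) = (a - b) \<bullet> (P' *v (a - b)) + qd"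
        unfolding qd_def by (rule formP)
      moreover have "2 * (b \<bullet> (G (x k) - G xs)) \<ge> b \<bullet> (Q *v b) - qd"
        unfolding qd_def by (rule grad)
      moreover have "(y' - y) \<bullet> (W *v (y' - y)) \<ge> 0" using W_psd by (simp add: possemidef_def)
      moreover have "a \<bullet> (R *v a) = a \<bullet> (P *v a) + qa" unfolding qa_def by (rule formR)
      moreover have "bR = b \<bullet> (P *v b) + qb" unfolding bR_def qb_def by (rule formR)
      moreover have "a \<bullet> (P *v a) + y \<bullet> (W *v y) =
        b \<bullet> (P *v b) + yW + (a - b) \<bullet> (P *v (a - b)) + (y' - y) \<bullet> (W *v (y' - y))
        + 2 * (b \<bullet> (G (x k) - G xs)) + 2 * (b \<bullet> w) - 2 * (y' \<bullet> (W *v e'))"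
        unfolding yW_def by (rule energy)
      moreover have "N * EC = T1 + T2 + T3" unfolding T1_def T2_def T3_def by (rule EC)
      ultimately have "(\<sigma> + 1) * (bR + yW) \<le> a \<bullet> (R *v a) + y \<bullet> (W *v y) + 2 * (N * EC)"
        by linarith
      then show ?thesis by (simp only: bR_def yW_def)
    qed
    have "matrix_inv W *v (zs - z (Suc k)) = - (matrix_inv W *v (z (Suc k) - zs))"
      by (metis matrix_vector_mult_diff_distrib minus_diff_eq)
    then have "(wnorm (matrix_inv W) (zs - z (Suc k)))\<^sup>2 = (wnorm (matrix_inv W) (z (Suc k) - zs))\<^sup>2"
      by (simp add: wnorm_def inner_diff_left)
    also have "\<dots> = y' \<bullet> (W *v y')"
      unfolding y'_def by (rule wnorm_matrix_inv_power2[OF W_pd])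
    finally have "(wnorm (matrix_inv W) (zs - z (Suc k)))\<^sup>2 = y' \<bullet> (W *v y')" .
    moreover have "(wnorm (matrix_inv W) (z k - zs))\<^sup>2 = y \<bullet> (W *v y)"
      unfolding y_def by (rule wnorm_matrix_inv_power2[OF W_pd])
    moreover have "(wnorm R u)\<^sup>2 = u \<bullet> (R *v u)" for u
      using R_pd by (simp add: wnorm_power2 posdef_imp_possemidef)
    moreover have EN: "?n * EC * (?E k)\<^sup>2 = N * EC" by (simp add: N_def)
    ultimately show ?thesis
      unfolding a_def[symmetric] b_def[symmetric] EC_def[symmetric] EN using fin by simp
  qed
  show ?thesis
    unfolding R_def[symmetric]
  \<comment> \<open>The margin \<open>s\<close> was fixed without reference to \<open>k5\<close>, so
    it can serve as the upper bound, with \<open>\<sigma> = s - k5\<close>.\<close>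
  proof (rule exI[of _ s], intro conjI allI impI)
    fix k5 assume k5: "0 < k5 \<and> k5 < s"
    show "\<exists>\<sigma>>0. \<forall>k. 1/2 * (wnorm R (x k - xs))\<^sup>2 + 1/2 * (wnorm (matrix_inv W) (z k - zs))\<^sup>2
      + ?n * error_const \<beta> L R k2 k3 k5 \<sigma> * (?E k)\<^sup>2
      \<ge> (\<sigma> + 1) / 2 * ((wnorm R (x (Suc k) - xs))\<^sup>2 + (wnorm (matrix_inv W) (zs - z (Suc k)))\<^sup>2)"
      using k5 by (intro exI[of _ "s - k5"] conjI allI step) auto
  qed (rule s)
qed

end
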